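(* Let $n\ge 2$, let $L_n=\mathbf I-\sum_{i>j}\mathbf e_i\mathbf e_j^T\in\mathbb R^{n\times n}$, and let $$\alpha_j=1+\tfrac23\,(4^{j-1}-1)\qquad (j\ge 1).$$ Then the QR factorization of $L_n$ has orthogonal factor $Q_n=\hat Q\hat D^{-1/2}$, where $\hat Q$ and $\hat D$ are the $n\times n$ matrices given as follows. First, $$\hat Q_{:,n-1}=\mathbf e_{n-1}-\mathbf e_n,\qquad \hat Q_{i,n}=\begin{cases}2^{n-1-i}, & i<n\\ 1,& i=n,\end{cases}$$ and, for $n\ge 3$ and $j\le n-2$, $$\hat Q_{ij}=\begin{cases}-(n-j-1)2^{j-i-1}, & i<j\\ (n-j)(\alpha_j-1)+1,& i=j\\ -\alpha_j,& i>j.\end{cases}$$ Next, $\hat D$ is the diagonal matrix with $\hat D_{11}=n$, $\hat D_{n-1,n-1}=2$, $\hat D_{nn}=2\alpha_{n-1}$ and, when $n\ge 4$, $$\hat D_{jj}=(n-j)^2(\alpha_j-1)^2\cdot\frac{2\alpha_j-1}{2\alpha_j-2}+(n-j)(\alpha_j^2+\alpha_j-1)+2\alpha_{j-1},\qquad 2\le j\le n-2 .$$ Moreover, for all $1\le k\le n$, the intermediate GENP (and GEPP) form $\hat Q^{(k)}$ of $\hat Q$ is given by $$\hat Q^{(k)}_{:,n-1}=\begin{cases}\mathbf e_{n-1}-\mathbf e_n,& k<n\\ \mathbf e_{n-1},& k=n,\end{cases}\qquad \hat Q^{(k)}_{in}=\begin{cases}2^{n-i-1}+2^{n-k-1}(\alpha_k-1),&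 k<i<n\\ 2^{n-i-1}\alpha_i,& i\le k<n\\ 2^{n-i-1}\alpha_i,& i<k=n\\ 1+2^{n-k-1}(\alpha_k-1),& k<i=n\\ 2\alpha_{n-1},& k=i=n,\end{cases}$$ and, for $n\ge 3$ and $j\le n-2$, $$\hat Q^{(k)}_{ij}=\begin{cases} -(n-j-1)\left[2^{j-i-1}+2^{j-k-1}(\alpha_k-1)\right],& k<i<j\\ -(n-j-1)2^{j-i-1}\alpha_i,& i\le k<j\\ -(n-j-1)2^{j-i-1}\alpha_i,& i<j\le k\\ \left[(n-j)(\alpha_j-1)+1\right]-(n-j-1)2^{j-k-1}(\alpha_k-1),& k<i=j\\ \tfrac12(n-j+1)(\alpha_j-1)+1,& i=j\le k\\ -\alpha_j-(n-j-1)2^{j-k-1}(\alpha_k-1),& k\le j<i\\ 0,& j<i\ \text{and}\ j<k. \end{cases}$$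
   Context: $\mathbf e_i$ are the standard basis vectors and $\mathbf I$ the identity; $A_{:,j}$ is column $j$ of $A$. The QR factorization of a nonsingular $A$ is the unique $A=QR$ with $Q$ orthogonal and $R$ upper triangular with positive diagonal; $Q$ is called the orthogonal (QR) factor of $A$. All computations are in exact arithmetic. Gaussian elimination without pivoting (GENP) produces $A=A^{(1)},A^{(2)},\dots,A^{(n)}$, where $A^{(k+1)}$ is obtained from $A^{(k)}$ by subtracting, for each $i>k$, the multiple $A^{(k)}_{ik}/A^{(k)}_{kk}$ of row $k$ from row $i$. Thus $A^{(k)}$ has zeros below its first $k-1$ diagonal entries. Gaussian elimination with partial pivoting (GEPP) additionally performs, at the start of step $k$, a row swap bringing an entry of maximal absolute value among $A^{(k)}_{ik}$, $i\ge k$, to position $(k,k)$, with no swap performed if the entry in position $(k,k)$ is already of maximal absolute value. *)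

theory Defs
  imports Complex_Main "Jordan_Normal_Form.Gauss_Jordan_Elimination"
begin

(* Matrices of the library are indexed from 0. The following two operations give access to them
   with the indices 1, ..., n used in the mathematics; all formulas below are 1-based. *)

definition mat1 :: "nat \<Rightarrow> (nat \<Rightarrow> nat \<Rightarrow> real) \<Rightarrow> real mat" where
  "mat1 n f = mat n n (\<lambda>(i, j). f (i + 1) (j + 1))"

definition entry :: "real mat \<Rightarrow> nat \<Rightarrow> nat \<Rightarrow> real" where
  "entry A i j = A $$ (i - 1, j - 1)"


section \<open>QR factorization\<close>

(* The predicate orthogonal_mat of Jordan_Normal_Form only asks for pairwise orthogonal nonzero
   columns, so orthonormality is spelled out here. *)

definition is_qr_factorization :: "real mat \<Rightarrow> real mat \<Rightarrow> real mat \<Rightarrow> bool" where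
  "is_qr_factorization A Q R \<longleftrightarrow>
     invertible_mat A \<and>
     Q \<in> carrier_mat (dim_row A) (dim_row A) \<and>
     R \<in> carrier_mat (dim_row A) (dim_row A) \<and>
     A = Q * R \<and>
     transpose_mat Q * Q = 1\<^sub>m (dim_row A) \<and>
     upper_triangular R \<and>
     (\<forall>i < dim_row A. 0 < R $$ (i, i))"

definition qr_orthogonal_factor :: "real mat \<Rightarrow> real mat" where
  "qr_orthogonal_factor A = (THE Q. \<exists>R. is_qr_factorization A Q R)"


section \<open>Gaussian elimination\<close>

definition eliminate :: "nat \<Rightarrow> real mat \<Rightarrow> real mat" where
  "eliminate k A = mat1 (dim_row A) (\<lambda>i j.
     if k < i then entry A i j - entry A i k / entry A k k * entry A k j else entry A i j)"

(* genp_form A k B: elimination without pivoting reaches step k without meeting a zero pivot,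
   and B is the form A^(k). There is no such B if the elimination breaks down before. *)

inductive genp_form :: "real mat \<Rightarrow> nat \<Rightarrow> real mat \<Rightarrow> bool" for A where
  genp_start: "genp_form A 1 A"
| genp_step: "genp_form A (k + 1) (eliminate k B)"
    if "genp_form A k B" "k < dim_row B" "entry B k k \<noteq> 0"

(* p is an admissible pivot row in step k; ties are broken arbitrarily, except that row k is
   kept whenever it is itself admissible. *)

definition pivot_row :: "nat \<Rightarrow> real mat \<Rightarrow> nat \<Rightarrow> bool" where
  "pivot_row k B p \<longleftrightarrow>
     p \<in> {k..dim_row B} \<and>
     (\<forall>i \<in> {k..dim_row B}. \<bar>entry B i k\<bar> \<le> \<bar>entry B p k\<bar>) \<and>
     ((\<forall>i \<in> {k..dim_row B}. \<bar>entry B i k\<bar> \<le> \<bar>entry B k k\<bar>) \<longrightarrow> p = k)"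

(* gepp_form A k B: some run of elimination with partial pivoting has the form B at the beginning
   of step k, that is, before the row swap of that step. *)

inductive gepp_form :: "real mat \<Rightarrow> nat \<Rightarrow> real mat \<Rightarrow> bool" for A where
  gepp_start: "gepp_form A 1 A"
| gepp_step: "gepp_form A (k + 1) (eliminate k C)"
    if "gepp_form A k B" "k < dim_row B" "pivot_row k B p"
       "C = swaprows (k - 1) (p - 1) B" "entry C k k \<noteq> 0"


section \<open>The matrices\<close>

definition L_mat :: "nat \<Rightarrow> real mat" where
  "L_mat n = 1\<^sub>m n - mat1 n (\<lambda>i j. if i > j then 1 else 0)"

definition alpha :: "nat \<Rightarrow> real" where
  "alpha j = 1 + 2 / 3 * (4 ^ (j - 1) - 1)"

definition Q_hat :: "nat \<Rightarrow> real mat" where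
  "Q_hat n = mat1 n (\<lambda>i j.
     if j = n - 1 then
       (if i = n - 1 then 1 else 0) - (if i = n then 1 else 0)
     else if j = n then
       (if i < n then 2 powi (int n - 1 - int i) else 1)
     else
       (if i < j then - (real n - real j - 1) * 2 powi (int j - int i - 1)
        else if i = j then (real n - real j) * (alpha j - 1) + 1
        else - alpha j))"

(* For n = 2 the values prescribed for the entries (1, 1) and (n - 1, n - 1) coincide. *)

definition d_hat :: "nat \<Rightarrow> nat \<Rightarrow> real" where
  "d_hat n j =
     (if j = n then 2 * alpha (n - 1)
      else if j = n - 1 then 2
      else if j = 1 then real n
      else (real n - real j)^2 * (alpha j - 1)^2 * ((2 * alpha j - 1) / (2 * alpha j - 2))
           + (real n - real j) * ((alpha j)^2 + alpha j - 1) + 2 * alpha (j - 1))"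

definition D_hat :: "nat \<Rightarrow> real mat" where
  "D_hat n = mat1 n (\<lambda>i j. if i = j then d_hat n j else 0)"

lemma alpha_ge_1: "1 \<le> alpha j"
  by (simp add: alpha_def)

lemma d_hat_pos:
  assumes "2 \<le> n" "1 \<le> j" "j \<le> n"
  shows "0 < d_hat n j"
proof -
  have "0 \<le> (alpha j)^2 + alpha j - 1" "0 < alpha (j - 1)" "0 < alpha (n - 1)"
    using alpha_ge_1[of j] alpha_ge_1[of "j - 1"] alpha_ge_1[of "n - 1"]
    by (simp_all add: add_increasing)
  moreover have "0 \<le> (2 * alpha j - 1) / (2 * alpha j - 2)"
    using alpha_ge_1[of j] by (intro divide_nonneg_nonneg) auto
  ultimately show ?thesis
    using assms unfolding d_hat_def
    by (auto intro!: add_nonneg_pos add_nonneg_nonneg mult_nonneg_nonneg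
        simp del: times_divide_eq_right times_divide_eq_left)
qed

(* D^(-1/2) for a diagonal matrix D with positive diagonal; D_hat n is one by d_hat_pos. *)

definition diag_inv_sqrt :: "real mat \<Rightarrow> real mat" where
  "diag_inv_sqrt D = mat1 (dim_row D) (\<lambda>i j. if i = j then 1 / sqrt (entry D j j) else 0)"

(* The exponents are integers because j - k - 1 = -1 occurs (for k = j < i). *)

definition Q_hat_form :: "nat \<Rightarrow> nat \<Rightarrow> real mat" where
  "Q_hat_form n k = mat1 n (\<lambda>i j.
     if j = n - 1 then
       (if k < n then (if i = n - 1 then 1 else 0) - (if i = n then 1 else 0)
        else (if i = n - 1 then 1 else 0))
     else if j = n then
       (if k < i \<and> i < n then
          2 powi (int n - int i - 1) + 2 powi (int n - int k - 1) * (alpha k - 1)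
        else if i \<le> k \<and> k < n then 2 powi (int n - int i - 1) * alpha i
        else if i < k \<and> k = n then 2 powi (int n - int i - 1) * alpha i
        else if k < i \<and> i = n then 1 + 2 powi (int n - int k - 1) * (alpha k - 1)
        else 2 * alpha (n - 1))
     else
       (if k < i \<and> i < j then
          - (real n - real j - 1)
            * (2 powi (int j - int i - 1) + 2 powi (int j - int k - 1) * (alpha k - 1))
        else if i \<le> k \<and> k < j then
          - (real n - real j - 1) * 2 powi (int j - int i - 1) * alpha i
        else if i < j \<and> j \<le> k then
          - (real n - real j - 1) * 2 powi (int j - int i - 1) * alpha i
        else if k < i \<and> i = j then
          ((real n - real j) * (alpha j - 1) + 1)
            - (real n - real j - 1) * 2 powi (int j - int k - 1) * (alpha k - 1)
        else if i = j \<and> j \<le> k then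
          1 / 2 * (real n - real j + 1) * (alpha j - 1) + 1
        else if k \<le> j \<and> j < i then
          - alpha j - (real n - real j - 1) * 2 powi (int j - int k - 1) * (alpha k - 1)
        else 0))"

end

theory Submission
  imports Defs "Jordan_Normal_Form.Determinant"
begin

text \<open>Everything follows from one factorization: \<open>Q_hat n = L_mat n * U\<close> with \<open>U\<close> upper triangular with
  positive diagonal. Here \<open>L_mat n\<close>, the matrix whose QR factor is wanted, has the role of the factor
  \<open>L\<close> in an LU factorization.

  \<^bold>\<open>Elimination.\<close> As \<open>L_mat n\<close> is unit lower triangular, it collects the multipliers of the elimination
  applied to \<open>Q_hat n\<close>. All of them are equal to -1, so every step adds the pivot row to each row below
  it, and the \<open>k\<close>-th form is explicit in terms of \<open>U\<close> (\<open>elimination_of_L_mult\<close>). A multiplier of absolute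
  value 1 also means that the pivot already has maximal absolute value in its column, hence partial
  pivoting never swaps rows. Summing the columns of \<open>U\<close> (\<open>U_gen_column_sum\<close>) then gives
  \<open>Q_hat_form n k\<close>.

  \<^bold>\<open>Orthogonality.\<close> With \<open>Q\<close> for \<open>Q_hat n\<close>, the matrix \<open>T = transpose_mat Q * L_mat n\<close> is upper triangular,
  because each entry of \<open>Q\<close> above the diagonal is the sum of the entries below it in its column
  (\<open>Q_gen_tail_sum\<close>). Therefore \<open>transpose_mat Q * Q = T * U\<close> is upper triangular, and being symmetric
  it is diagonal, with the products of the diagonal entries of \<open>T\<close> and \<open>U\<close> on its diagonal. These are
  the numbers \<open>d_hat n j\<close> (\<open>d_hat_eq\<close>). After normalization of the columns of \<open>Q\<close>, the same \<open>T\<close> with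
  rescaled rows is the triangular factor (\<open>qr_factorization_of_gram\<close>). The QR factorization is unique
  by uniqueness of the Cholesky factorization (\<open>qr_factorization_unique\<close>).

  The case distinctions of the formulas disappear if column \<open>n - 1\<close> of \<open>Q_hat n\<close> is multiplied by
  \<open>alpha (n - 1)\<close>: then all columns, the last two included, are given by the formula for the first
  \<open>n - 2\<close> of them (\<open>Q_hat_eq\<close>). A scaling of columns has no influence on the multipliers or on the
  triangular shapes, and so the scale factors are simply carried along in \<open>U\<close> and \<open>T\<close>.\<close>

section \<open>Triangular matrices and uniqueness of the QR factorization\<close>

lemma index_mult_mat_sum:
  assumes "A \<in> carrier_mat n n" "B \<in> carrier_mat n n" "i < n" "j < n"
  shows "(A * B) $$ (i, j) = (\<Sum>l<n. A $$ (i, l) * B $$ (l, j))"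
  using assms by (simp add: scalar_prod_def atLeast0LessThan)

lemma index_transpose_mult:
  assumes "A \<in> carrier_mat n n" "B \<in> carrier_mat n n" "i < n" "j < n"
  shows "(transpose_mat A * B) $$ (i, j) = (\<Sum>l<n. A $$ (l, i) * B $$ (l, j))"
  using assms by (simp add: scalar_prod_def atLeast0LessThan)

lemma upper_triangular_mult_index:
  fixes T U :: "'a :: comm_ring_1 mat"
  assumes "T \<in> carrier_mat n n" "U \<in> carrier_mat n n"
    and "upper_triangular T" "upper_triangular U" "i < n" "j \<le> i"
  shows "(T * U) $$ (i, j) = (if i = j then T $$ (i, i) * U $$ (i, i) else 0)"
proof -
  have "T $$ (i, l) * U $$ (l, j) = (if l = i then (if i = j then T $$ (i, i) * U $$ (i, i) else 0) else 0)"
    if "l < n" for l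
  proof (cases l i rule: linorder_cases)
    case less
    then show ?thesis using assms by (simp add: upper_triangular_def)
  next
    case equal
    then show ?thesis using assms by (auto simp: upper_triangular_def)
  next
    case greater
    then show ?thesis using assms that by (simp add: upper_triangular_def)
  qed
  then show ?thesis
    using assms by (simp add: index_mult_mat_sum[of T n U] del: index_mult_mat(1))
qed

lemma det_upper_triangular_pos:
  fixes T :: "real mat"
  assumes "T \<in> carrier_mat n n" "upper_triangular T" "\<And>i. i < n \<Longrightarrow> 0 < T $$ (i, i)"
  shows "0 < det T"
  using assms by (auto simp: det_upper_triangular prod_list_diag_prod intro!: prod_pos)

lemma invertible_mat_of_det:
  fixes A :: "real mat"
  assumes "A \<in> carrier_mat n n" "det A \<noteq> 0"
  shows "invertible_mat A"
proof -
  obtain B where "B \<in> carrier_mat n n" "B * A = 1\<^sub>m n" "A * B = 1\<^sub>m n"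
    using det_non_zero_imp_unit[OF assms, where b = undefined]
    by (auto simp: Units_def ring_mat_def)
  then show ?thesis
    using assms(1) by (auto simp: invertible_mat_def inverts_mat_def)
qed

lemma invertible_matE:
  fixes A :: "real mat"
  assumes "invertible_mat A" "A \<in> carrier_mat n n"
  obtains B where "B \<in> carrier_mat n n" "A * B = 1\<^sub>m n"
proof -
  obtain B where B: "A * B = 1\<^sub>m (dim_row A)" "B * A = 1\<^sub>m (dim_row B)"
    using assms by (auto simp: invertible_mat_def inverts_mat_def)
  have "B \<in> carrier_mat n n"
    using arg_cong[OF B(1), of dim_col] arg_cong[OF B(2), of dim_col] assms(2)
    by auto
  then show thesis
    using that B assms(2) by auto
qed

text \<open>Equating the entries of row \<open>i\<close> in the two Gram matrices, the rows above \<open>i\<close> already agree and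
  the rows below do not contribute. The entry on the diagonal thus determines the square of the
  positive number \<open>R $$ (i, i)\<close>, and each other entry of the row is determined after division by
  this number.\<close>

lemma cholesky_unique:
  fixes R S :: "real mat"
  assumes R: "R \<in> carrier_mat n n" "upper_triangular R" "\<And>i. i < n \<Longrightarrow> 0 < R $$ (i, i)"
    and S: "S \<in> carrier_mat n n" "upper_triangular S" "\<And>i. i < n \<Longrightarrow> 0 < S $$ (i, i)"
    and eq: "transpose_mat R * R = transpose_mat S * S"
  shows "R = S"
proof -
  have row: "\<forall>j<n. R $$ (i, j) = S $$ (i, j)" if "i < n" for i
    using that
  proof (induction i rule: less_induct)
    case (less i)
    have split: "(\<Sum>l<n. M $$ (l, i) * M $$ (l, j)) =
        (\<Sum>l<i. M $$ (l, i) * M $$ (l, j)) + M $$ (i, i) * M $$ (i, j)"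
      if "M \<in> carrier_mat n n" "upper_triangular M" for M :: "real mat" and j
    proof -
      have "(\<Sum>l<n. M $$ (l, i) * M $$ (l, j)) = (\<Sum>l<Suc i. M $$ (l, i) * M $$ (l, j))"
        using that less.prems by (intro sum.mono_neutral_right) auto
      then show ?thesis by simp
    qed
    have prod: "R $$ (i, i) * R $$ (i, j) = S $$ (i, i) * S $$ (i, j)" if "j < n" for j
    proof -
      have "(\<Sum>l<n. R $$ (l, i) * R $$ (l, j)) = (\<Sum>l<n. S $$ (l, i) * S $$ (l, j))"
        using eq index_transpose_mult[OF R(1) R(1) less.prems that]
          index_transpose_mult[OF S(1) S(1) less.prems that] by simp
      moreover have "(\<Sum>l<i. R $$ (l, i) * R $$ (l, j)) = (\<Sum>l<i. S $$ (l, i) * S $$ (l, j))"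
        using less that by (intro sum.cong) auto
      ultimately show ?thesis
        using split[OF R(1,2)] split[OF S(1,2)] by simp
    qed
    have "(R $$ (i, i))\<^sup>2 = (S $$ (i, i))\<^sup>2"
      using prod[OF less.prems] by (simp add: power2_eq_square)
    then have "R $$ (i, i) = S $$ (i, i)"
      using R(3)[OF less.prems] S(3)[OF less.prems] by (simp add: power2_eq_iff)
    then show ?case
      using prod S(3)[OF less.prems] by force
  qed
  show ?thesis
    using row R(1) S(1) by (intro eq_matI) auto
qed

text \<open>The triangular factor is the Cholesky factor of the Gram matrix of \<open>A\<close>, hence unique, and as
  it is invertible it determines the orthogonal factor.\<close>

lemma qr_factorization_unique:
  assumes "is_qr_factorization A Q R" "is_qr_factorization A P S"
  shows "Q = P"
proof -
  define n where "n = dim_row A"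
  have inv: "invertible_mat A"
    and QR: "Q \<in> carrier_mat n n" "R \<in> carrier_mat n n" "A = Q * R"
      "transpose_mat Q * Q = 1\<^sub>m n" "upper_triangular R" "\<And>i. i < n \<Longrightarrow> 0 < R $$ (i, i)"
    and PS: "P \<in> carrier_mat n n" "S \<in> carrier_mat n n" "A = P * S"
      "transpose_mat P * P = 1\<^sub>m n" "upper_triangular S" "\<And>i. i < n \<Longrightarrow> 0 < S $$ (i, i)"
    using assms unfolding is_qr_factorization_def n_def by blast+
  have A: "A \<in> carrier_mat n n"
    unfolding QR(3) using QR(1,2) by simp
  have gram: "transpose_mat A * A = transpose_mat Z * Z"
    if "A = X * Z" "X \<in> carrier_mat n n" "Z \<in> carrier_mat n n" "transpose_mat X * X = 1\<^sub>m n" for X Z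
  proof -
    have "transpose_mat A * A = transpose_mat Z * (transpose_mat X * (X * Z))"
      using that by (simp add: transpose_mult[of _ n n] assoc_mult_mat[of _ n n _ n _ n])
    also have "transpose_mat X * (X * Z) = (transpose_mat X * X) * Z"
      using that by (intro assoc_mult_mat[symmetric]) auto
    finally show ?thesis using that by simp
  qed
  have "transpose_mat R * R = transpose_mat S * S"
    using gram[OF QR(3,1,2,4)] gram[OF PS(3,1,2,4)] by (rule subst)
  then have RS: "R = S"
    using cholesky_unique[OF QR(2,5,6) PS(2,5,6)] by blast
  obtain B where B: "B \<in> carrier_mat n n" "A * B = 1\<^sub>m n"
    using invertible_matE[OF inv A] .
  have RB: "R * B \<in> carrier_mat n n"
    using QR(2) B(1) by simp
  have QRB: "Q * (R * B) = 1\<^sub>m n"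
    using assoc_mult_mat[OF QR(1,2) B(1)] B(2) unfolding QR(3)[symmetric] by simp
  have PRB: "P * (R * B) = 1\<^sub>m n"
    using assoc_mult_mat[OF PS(1,2) B(1)] B(2) unfolding PS(3)[symmetric] RS by simp
  have "P * ((R * B) * Q) = P"
    using mat_mult_left_right_inverse[OF QR(1) RB QRB] PS(1) by simp
  moreover have "P * ((R * B) * Q) = Q"
    using assoc_mult_mat[OF PS(1) RB QR(1)] PRB QR(1) by simp
  ultimately show ?thesis by simp
qed

text \<open>Since \<open>P = A * U\<close>, the Gram matrix of \<open>P\<close> is \<open>(transpose_mat P * A) * U\<close>, a product of upper
  triangular matrices. Being symmetric as well, it is
  diagonal, and its diagonal is that of the product. So the columns of \<open>P\<close> are orthogonal without any
  computation of their inner products, and it remains to normalize them.\<close>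

lemma qr_factorization_of_gram:
  fixes A P U D :: "real mat"
  assumes A: "A \<in> carrier_mat n n" and P: "P \<in> carrier_mat n n" and U: "U \<in> carrier_mat n n"
    and PAU: "P = A * U" and utU: "upper_triangular U"
    and utT: "upper_triangular (transpose_mat P * A)"
    and Upos: "\<And>i. i < n \<Longrightarrow> 0 < U $$ (i, i)"
    and Tpos: "\<And>i. i < n \<Longrightarrow> 0 < (transpose_mat P * A) $$ (i, i)"
    and D: "D \<in> carrier_mat n n"
    and Dii: "\<And>i. i < n \<Longrightarrow> D $$ (i, i) = (transpose_mat P * A) $$ (i, i) * U $$ (i, i)"
  shows "is_qr_factorization A (P * diag_inv_sqrt D) (diag_inv_sqrt D * (transpose_mat P * A))"
proof -
  define T where "T = transpose_mat P * A"
  define S where "S = diag_inv_sqrt D"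
  define Q where "Q = P * S"
  have T: "T \<in> carrier_mat n n" using A P by (simp add: T_def)
  have S: "S \<in> carrier_mat n n" using D by (auto simp: S_def diag_inv_sqrt_def mat1_def)
  have Q: "Q \<in> carrier_mat n n" using P S by (simp add: Q_def)
  have S_ij: "S $$ (i, j) = (if i = j then 1 / sqrt (D $$ (i, i)) else 0)" if "i < n" "j < n" for i j
    using that D by (auto simp: S_def diag_inv_sqrt_def mat1_def entry_def)
  have utS: "upper_triangular S"
    using S S_ij by auto
  have Dpos: "0 < D $$ (i, i)" if "i < n" for i
    using that Dii Tpos Upos by simp
  have SX: "(S * X) $$ (i, j) = X $$ (i, j) / sqrt (D $$ (i, i))"
    if "i < n" "j < n" "X \<in> carrier_mat n n" for X i j
    using that S
    by (simp add: index_mult_mat_sum[of S n X] S_ij if_distrib[of "\<lambda>x. x * _"]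
        del: index_mult_mat(1) cong: if_cong)
  have XS: "(X * S) $$ (i, j) = X $$ (i, j) / sqrt (D $$ (j, j))"
    if "i < n" "j < n" "X \<in> carrier_mat n n" for X i j
    using that S
    by (simp add: index_mult_mat_sum[of X n S] S_ij if_distrib[of "\<lambda>x. _ * x"]
        del: index_mult_mat(1) cong: if_cong)
  have PP: "transpose_mat P * P \<in> carrier_mat n n"
    and PPS: "(transpose_mat P * P) * S \<in> carrier_mat n n"
    using P S by auto
  have gram: "transpose_mat P * P = T * U"
    using A P U by (simp add: T_def PAU assoc_mult_mat[of _ n n _ n _ n])
  have gram_ij: "(transpose_mat P * P) $$ (i, j) = (if i = j then D $$ (i, i) else 0)"
    if "i < n" "j < n" for i j
  proof -
    have lower: "(transpose_mat P * P) $$ (i, j) = (if i = j then D $$ (i, i) else 0)"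
      if "i < n" "j \<le> i" for i j
      unfolding gram using that Dii utU utT T U
      by (simp add: upper_triangular_mult_index[of T n U] del: index_mult_mat(1) flip: T_def)
    have "(transpose_mat P * P) $$ (i, j) = (transpose_mat P * P) $$ (j, i)"
      using that P by (simp add: index_transpose_mult[of P n P] mult.commute del: index_mult_mat(1))
    then show ?thesis
      using lower[of i j] lower[of j i] that by (cases "j \<le> i") auto
  qed
  have St: "transpose_mat S = S"
    using S S_ij by (intro eq_matI) auto
  have "transpose_mat Q * Q = S * ((transpose_mat P * P) * S)"
    using P S by (simp add: Q_def transpose_mult[of _ n n] St assoc_mult_mat[of _ n n _ n _ n])
  also have "\<dots> = 1\<^sub>m n"
  proof (rule eq_matI)
    fix i j assume ij: "i < dim_row (1\<^sub>m n :: real mat)" "j < dim_col (1\<^sub>m n :: real mat)"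
    have "(S * ((transpose_mat P * P) * S)) $$ (i, j)
        = (transpose_mat P * P) $$ (i, j) / sqrt (D $$ (j, j)) / sqrt (D $$ (i, i))"
      using ij SX[OF _ _ PPS] XS[OF _ _ PP] by simp
    also have "\<dots> = 1\<^sub>m n $$ (i, j)"
      using ij Dpos[of i] by (auto simp: gram_ij simp del: index_mult_mat(1) assoc_mult_mat)
    finally show "(S * ((transpose_mat P * P) * S)) $$ (i, j) = 1\<^sub>m n $$ (i, j)" .
  qed (use P S in auto)
  finally have orth: "transpose_mat Q * Q = 1\<^sub>m n" .
  have ut: "upper_triangular (S * T)"
    using S T utS utT
    by (auto simp: upper_triangular_mult_index[of S n T] simp del: index_mult_mat(1) simp flip: T_def)
  have pos: "0 < (S * T) $$ (i, i)" if "i < n" for i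
    using that Dpos Tpos T by (simp add: SX del: index_mult_mat(1) flip: T_def)
  have "A = (Q * transpose_mat Q) * A"
    using mat_mult_left_right_inverse[of "transpose_mat Q" n Q] Q A orth by simp
  also have "\<dots> = Q * (S * T)"
    using A P S by (simp add: Q_def T_def transpose_mult[of _ n n] St assoc_mult_mat[of _ n n _ n _ n])
  finally have fact: "A = Q * (S * T)" .
  have "det (transpose_mat P) * det A = det T"
    using A P by (simp add: T_def det_mult[of _ n])
  moreover have "0 < det T"
    using T utT Tpos by (intro det_upper_triangular_pos) (auto simp: T_def)
  ultimately have "det A \<noteq> 0" by auto
  then have "invertible_mat A"
    using invertible_mat_of_det[OF A] by simp
  moreover have dim: "dim_row A = n" and "S * T \<in> carrier_mat n n"
    using A S T by auto
  ultimately show ?thesis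
    unfolding is_qr_factorization_def T_def[symmetric] S_def[symmetric] Q_def[symmetric] dim
    using Q fact orth ut pos by blast
qed

lemma qr_orthogonal_factor_eqI:
  assumes "is_qr_factorization A Q R"
  shows "qr_orthogonal_factor A = Q"
  unfolding qr_orthogonal_factor_def
  using assms qr_factorization_unique by (intro the_equality) blast+


section \<open>Matrices with indices from 1\<close>

lemma entry_mat1:
  assumes "1 \<le> i" "i \<le> n" "1 \<le> j" "j \<le> n"
  shows "entry (mat1 n f) i j = f i j"
  using assms by (simp add: entry_def mat1_def)

lemma dim_mat1 [simp]: "dim_row (mat1 n f) = n" "dim_col (mat1 n f) = n"
  "mat1 n f \<in> carrier_mat n n"
  by (simp_all add: mat1_def)

lemma mat1_cong:
  assumes "\<And>i j. 1 \<le> i \<Longrightarrow> i \<le> n \<Longrightarrow> 1 \<le> j \<Longrightarrow> j \<le> n \<Longrightarrow> f i j = g i j"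
  shows "mat1 n f = mat1 n g"
  using assms by (auto simp: mat1_def intro!: cong_mat)

lemma mult_mat1: "mat1 n f * mat1 n g = mat1 n (\<lambda>i j. \<Sum>l=1..n. f i l * g l j)"
  by (rule eq_matI)
    (auto simp: mat1_def scalar_prod_def sum.shift_bounds_cl_Suc_ivl atLeastLessThanSuc_atLeastAtMost
        intro!: sum.reindex_bij_witness[of _ "\<lambda>l. l - 1" Suc])

lemma transpose_mat1: "transpose_mat (mat1 n f) = mat1 n (\<lambda>i j. f j i)"
  by (rule eq_matI) (auto simp: mat1_def)

lemma upper_triangular_mat1:
  assumes "\<And>i j. 1 \<le> j \<Longrightarrow> j < i \<Longrightarrow> i \<le> n \<Longrightarrow> f i j = 0"
  shows "upper_triangular (mat1 n f)"
  using assms by (auto simp: mat1_def)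

definition L_entry :: "nat \<Rightarrow> nat \<Rightarrow> real" where
  "L_entry i j = (if i = j then 1 else if j < i then - 1 else 0)"

lemma L_mat_eq: "L_mat n = mat1 n L_entry"
  by (rule eq_matI) (auto simp: L_mat_def mat1_def L_entry_def)

text \<open>Multiplication by \<open>L_mat n\<close> subtracts from an entry all entries above it when applied from the
  left, and all entries to its right when applied from the right. Since the right multiplication is
  used on the transpose of \<open>Q_hat n\<close>, the latter sums run down a column of \<open>Q_hat n\<close>.\<close>

lemma L_entry_sum_left:
  assumes "1 \<le> i" "i \<le> n"
  shows "(\<Sum>l=1..n. L_entry i l * f l) = f i - (\<Sum>l\<in>{1..<i}. f l)"
proof -
  have "{1..n} = insert i ({1..<i} \<union> {i<..n})" using assms by auto
  then have "(\<Sum>l=1..n. L_entry i l * f l)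
      = L_entry i i * f i + ((\<Sum>l\<in>{1..<i}. L_entry i l * f l) + (\<Sum>l\<in>{i<..n}. L_entry i l * f l))"
    by (simp, subst sum.union_disjoint, auto)
  then show ?thesis by (simp add: L_entry_def sum_negf)
qed

lemma L_entry_sum_right:
  assumes "1 \<le> j" "j \<le> n"
  shows "(\<Sum>l=1..n. f l * L_entry l j) = f j - (\<Sum>l\<in>{j<..n}. f l)"
proof -
  have "{1..n} = insert j ({1..<j} \<union> {j<..n})" using assms by auto
  then have "(\<Sum>l=1..n. f l * L_entry l j)
      = f j * L_entry j j + ((\<Sum>l\<in>{1..<j}. f l * L_entry l j) + (\<Sum>l\<in>{j<..n}. f l * L_entry l j))"
    by (simp, subst sum.union_disjoint, auto)
  then show ?thesis by (simp add: L_entry_def sum_negf)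
qed


section \<open>Gaussian elimination with all multipliers equal to -1\<close>

lemma genp_form_index_pos: "genp_form A k B \<Longrightarrow> 1 \<le> k"
  by (erule genp_form.cases) auto

lemma gepp_form_index_pos: "gepp_form A k B \<Longrightarrow> 1 \<le> k"
  by (erule gepp_form.cases) auto

lemma genp_form_iff:
  assumes F1: "F 1 = A"
    and dim: "\<And>k. dim_row (F k) = n"
    and pivot: "\<And>k. 1 \<le> k \<Longrightarrow> k < n \<Longrightarrow> entry (F k) k k \<noteq> 0"
    and step: "\<And>k. 1 \<le> k \<Longrightarrow> k < n \<Longrightarrow> eliminate k (F k) = F (Suc k)"
    and k: "1 \<le> k" "k \<le> n"
  shows "genp_form A k B \<longleftrightarrow> B = F k"
  using k
proof (induction k arbitrary: B rule: nat_induct_at_least)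
  case base
  show ?case
  proof
    assume "genp_form A 1 B"
    then show "B = F 1"
      by cases (use F1 in \<open>auto dest: genp_form_index_pos\<close>)
  qed (use F1 genp_start[of A] in auto)
next
  case (Suc k)
  then have IH: "genp_form A k C \<longleftrightarrow> C = F k" for C by simp
  have "genp_form A (k + 1) (eliminate k (F k))"
    using IH[of "F k"] Suc by (intro genp_step) (auto simp: dim pivot)
  moreover have "B = eliminate k (F k)" if "genp_form A (Suc k) B"
    using that by cases (use IH Suc.hyps in auto)
  ultimately show ?case
    using step[of k] Suc by auto
qed

text \<open>As row \<open>k\<close> is an admissible pivot row in step \<open>k\<close>, the rule to keep it then leaves no choice:
  the row swap is trivial.\<close>

lemma gepp_form_iff:
  assumes F1: "F 1 = A"
    and dim: "\<And>k. dim_row (F k) = n"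
    and pivot: "\<And>k. 1 \<le> k \<Longrightarrow> k < n \<Longrightarrow> entry (F k) k k \<noteq> 0"
    and max: "\<And>k i. 1 \<le> k \<Longrightarrow> k < n \<Longrightarrow> k \<le> i \<Longrightarrow> i \<le> n \<Longrightarrow> \<bar>entry (F k) i k\<bar> \<le> \<bar>entry (F k) k k\<bar>"
    and step: "\<And>k. 1 \<le> k \<Longrightarrow> k < n \<Longrightarrow> eliminate k (F k) = F (Suc k)"
    and k: "1 \<le> k" "k \<le> n"
  shows "gepp_form A k B \<longleftrightarrow> B = F k"
  using k
proof (induction k arbitrary: B rule: nat_induct_at_least)
  case base
  show ?case
  proof
    assume "gepp_form A 1 B"
    then show "B = F 1"
      by cases (use F1 in \<open>auto dest: gepp_form_index_pos\<close>)
  qed (use F1 gepp_start[of A] in auto)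
next
  case (Suc k)
  then have IH: "gepp_form A k C \<longleftrightarrow> C = F k" for C by simp
  have row: "pivot_row k (F k) p \<longleftrightarrow> p = k" for p
    using Suc max by (auto simp: pivot_row_def dim)
  have swap: "swaprows (k - 1) (k - 1) (F k) = F k"
    by (rule eq_matI) auto
  have "gepp_form A (k + 1) (eliminate k (F k))"
    using IH[of "F k"] Suc row swap by (intro gepp_step) (auto simp: dim pivot)
  moreover have "B = eliminate k (F k)" if "gepp_form A (Suc k) B"
    using that
  proof cases
    case gepp_start
    then show ?thesis using Suc.hyps by simp
  next
    case (gepp_step k' B' p C)
    then show ?thesis using IH row swap by auto
  qed
  ultimately show ?case
    using step[of k] Suc by auto
qed

text \<open>Row \<open>i\<close> of \<open>L_mat n * mat1 n U\<close> is row \<open>i\<close> of \<open>U\<close> minus the rows above it. The first \<open>k - 1\<close> steps of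
  the elimination add back the pivot rows \<open>1, \<dots>, k - 1\<close> of \<open>U\<close>, which leaves the rows \<open>k, \<dots>, i - 1\<close> to
  be subtracted. For \<open>i \<le> k\<close> the sum is empty, and row \<open>i\<close> is final.\<close>

definition elim_form :: "nat \<Rightarrow> (nat \<Rightarrow> nat \<Rightarrow> real) \<Rightarrow> nat \<Rightarrow> real mat" where
  "elim_form n U k = mat1 n (\<lambda>i j. U i j - (\<Sum>l\<in>{k..<i}. U l j))"

lemma dim_row_elim_form [simp]: "dim_row (elim_form n U k) = n"
  by (simp add: elim_form_def)

text \<open>In the pivot column only row \<open>k\<close> of \<open>U\<close> contributes below the diagonal, so the multipliers are
  -1 and all candidates for the pivot have the same absolute value.\<close>

lemma elim_form_column:
  assumes ut: "\<And>i j. 1 \<le> j \<Longrightarrow> j < i \<Longrightarrow> i \<le> n \<Longrightarrow> U i j = 0"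
    and "1 \<le> k" "k \<le> i" "i \<le> n"
  shows "entry (elim_form n U k) i k = (if i = k then U k k else - U k k)"
proof (cases "i = k")
  case False
  then have "{k..<i} = insert k {k<..<i}" using assms by auto
  then have "(\<Sum>l\<in>{k..<i}. U l k) = U k k + (\<Sum>l\<in>{k<..<i}. U l k)" by simp
  also have "(\<Sum>l\<in>{k<..<i}. U l k) = 0"
    using assms by (intro sum.neutral) auto
  finally show ?thesis
    using assms False by (simp add: elim_form_def entry_mat1)
qed (use assms in \<open>simp add: elim_form_def entry_mat1\<close>)

lemma eliminate_elim_form:
  assumes ut: "\<And>i j. 1 \<le> j \<Longrightarrow> j < i \<Longrightarrow> i \<le> n \<Longrightarrow> U i j = 0"
    and "U k k \<noteq> 0" "1 \<le> k" "k < n"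
  shows "eliminate k (elim_form n U k) = elim_form n U (Suc k)"
proof -
  let ?E = "entry (elim_form n U k)"
  have "(if k < i then ?E i j - ?E i k / ?E k k * ?E k j else ?E i j)
      = U i j - (\<Sum>l\<in>{Suc k..<i}. U l j)"
    if "1 \<le> i" "i \<le> n" "1 \<le> j" "j \<le> n" for i j
  proof (cases "k < i")
    case True
    have "?E i k / ?E k k = - 1"
      using True that assms by (simp add: elim_form_column)
    moreover have "?E i j = U i j - (U k j + (\<Sum>l\<in>{Suc k..<i}. U l j))"
      using True that by (simp add: elim_form_def entry_mat1 sum.atLeast_Suc_lessThan)
    moreover have "?E k j = U k j"
      using that assms by (simp add: elim_form_def entry_mat1)
    ultimately show ?thesis
      using True by simp
  next
    case False
    then show ?thesis
      using that by (simp add: elim_form_def entry_mat1)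
  qed
  then show ?thesis
    unfolding eliminate_def dim_row_elim_form elim_form_def[of n U "Suc k"]
    by (intro mat1_cong)
qed

lemma elimination_of_L_mult:
  assumes ut: "\<And>i j. 1 \<le> j \<Longrightarrow> j < i \<Longrightarrow> i \<le> n \<Longrightarrow> U i j = 0"
    and diag: "\<And>i. 1 \<le> i \<Longrightarrow> i \<le> n \<Longrightarrow> U i i \<noteq> 0"
    and k: "1 \<le> k" "k \<le> n"
  shows "genp_form (L_mat n * mat1 n U) k B \<longleftrightarrow> B = elim_form n U k"
    and "gepp_form (L_mat n * mat1 n U) k B \<longleftrightarrow> B = elim_form n U k"
proof -
  have start: "elim_form n U 1 = L_mat n * mat1 n U"
    unfolding elim_form_def L_mat_eq mult_mat1 by (rule mat1_cong) (simp add: L_entry_sum_left del: One_nat_def)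
  have pivot: "entry (elim_form n U k) k k \<noteq> 0" if "1 \<le> k" "k < n" for k
    using that diag by (simp add: elim_form_column[of n U, OF ut])
  have max: "\<bar>entry (elim_form n U k) i k\<bar> \<le> \<bar>entry (elim_form n U k) k k\<bar>"
    if "1 \<le> k" "k < n" "k \<le> i" "i \<le> n" for k i
    using that by (simp add: elim_form_column[of n U, OF ut])
  have step: "eliminate k (elim_form n U k) = elim_form n U (Suc k)" if "1 \<le> k" "k < n" for k
    using that diag by (simp add: eliminate_elim_form ut)
  show "genp_form (L_mat n * mat1 n U) k B \<longleftrightarrow> B = elim_form n U k"
    by (rule genp_form_iff[of "elim_form n U", OF start dim_row_elim_form pivot step k])
  show "gepp_form (L_mat n * mat1 n U) k B \<longleftrightarrow> B = elim_form n U k"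
    by (rule gepp_form_iff[of "elim_form n U", OF start dim_row_elim_form pivot max step k])
qed


section \<open>The two triangular factors of the Gram matrix\<close>

text \<open>The formula of the first \<open>n - 2\<close> columns of \<open>Q_hat n\<close>, read for all \<open>j \<le> n\<close>. For \<open>j = n\<close> the factor
  \<open>real n - real j - 1\<close> is -1 and the last column comes out; for \<open>j = n - 1\<close> the factor vanishes and
  column \<open>n - 1\<close> comes out multiplied by \<open>alpha (n - 1)\<close>.\<close>

definition Q_gen :: "nat \<Rightarrow> nat \<Rightarrow> nat \<Rightarrow> real" where
  "Q_gen n i j =
     (if i < j then - (real n - real j - 1) * 2 powi (int j - int i - 1)
      else if i = j then (real n - real j) * (alpha j - 1) + 1
      else - alpha j)"

text \<open>The last form of the elimination, again up to the scaling of column \<open>n - 1\<close>.\<close>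

definition U_gen :: "nat \<Rightarrow> nat \<Rightarrow> nat \<Rightarrow> real" where
  "U_gen n i j =
     (if i < j then - (real n - real j - 1) * 2 powi (int j - int i - 1) * alpha i
      else if i = j then 1 / 2 * (real n - real j + 1) * (alpha j - 1) + 1
      else 0)"

definition col_scale :: "nat \<Rightarrow> nat \<Rightarrow> real" where
  "col_scale n j = (if j = n - 1 then 1 / alpha j else 1)"

lemma alpha_1: "alpha (Suc 0) = 1"
  by (simp add: alpha_def)

lemma alpha_Suc:
  assumes "1 \<le> j"
  shows "alpha (Suc j) = 4 * alpha j - 1"
  using assms by (cases j) (simp_all add: alpha_def field_simps)

text \<open>Stated as an identity of exponents and not as a rule for \<open>2 powi (m + 1)\<close>, so that it fits the
  shape of the exponents of \<open>Q_gen\<close> and \<open>U_gen\<close>.\<close>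

lemma powi_pred: "(2::real) powi (int j - int i - 1) = 2 * 2 powi (int j - int (Suc i) - 1)"
  by (simp add: power_int_diff)

lemma col_scale_pos: "0 < col_scale n j"
  using alpha_ge_1[of j] by (auto simp: col_scale_def)

lemma U_gen_diag_pos:
  assumes "j \<le> n"
  shows "0 < U_gen n j j"
  using assms alpha_ge_1[of j] by (simp add: U_gen_def add_nonneg_pos)

lemma U_gen_last:
  assumes "2 \<le> n"
  shows "U_gen n n n = 2 * alpha (n - 1)"
proof -
  have "alpha n = 4 * alpha (n - 1) - 1"
    using assms alpha_Suc[of "n - 1"] by simp
  then show ?thesis
    unfolding U_gen_def by (simp only:) (simp add: field_simps)
qed

text \<open>This sum explains the terms with \<open>alpha k - 1\<close> in \<open>Q_hat_form\<close>: it is what the first \<open>k - 1\<close>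
  steps of the elimination have added to column \<open>j\<close> in each of the rows \<open>k, \<dots>, n\<close>. The induction
  amounts to \<open>2 * (2 * alpha k - 1) = alpha (Suc k) - 1\<close>.\<close>

lemma U_gen_column_sum:
  assumes "1 \<le> k" "k \<le> j"
  shows "(\<Sum>l\<in>{1..<k}. U_gen n l j) = - (real n - real j - 1) * 2 powi (int j - int k - 1) * (alpha k - 1)"
  using assms
proof (induction k rule: nat_induct_at_least)
  case base
  then show ?case by (simp add: alpha_1)
next
  case (Suc k)
  define p :: real where "p = 2 powi (int j - int (Suc k) - 1)"
  have p: "2 powi (int j - int k - 1) = 2 * p"
    unfolding p_def by (rule powi_pred)
  have "(\<Sum>l\<in>{1..<Suc k}. U_gen n l j) = (\<Sum>l\<in>{1..<k}. U_gen n l j) + U_gen n k j"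
    using Suc.hyps by simp
  also have "\<dots> = - (real n - real j - 1) * (2 * p) * (alpha k - 1)
      + - (real n - real j - 1) * (2 * p) * alpha k"
    using Suc.IH Suc.prems by (simp add: U_gen_def p del: One_nat_def)
  also have "\<dots> = - (real n - real j - 1) * p * (alpha (Suc k) - 1)"
    using Suc.hyps by (simp add: alpha_Suc algebra_simps)
  finally show ?case
    unfolding p_def .
qed

text \<open>This is the product \<open>L_mat n * U\<close> in terms of entries. For \<open>i \<le> j\<close> the column sum up to row
  \<open>i\<close> is known. Below the diagonal the sum is that of the whole column of \<open>U_gen\<close>, in which
  \<open>n\<close> cancels and \<open>alpha j\<close> remains; this is why these entries of \<open>Q_gen\<close> are constant.\<close>

lemma Q_gen_eq:
  assumes "1 \<le> i" "1 \<le> j"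
  shows "Q_gen n i j = U_gen n i j - (\<Sum>l\<in>{1..<i}. U_gen n l j)"
proof (cases "i \<le> j")
  case True
  then show ?thesis
    using assms U_gen_column_sum[of i j n]
    by (auto simp: Q_gen_def U_gen_def power_int_minus field_simps simp del: One_nat_def)
next
  case False
  then have "{1..<i} = {1..<j} \<union> {j} \<union> {j<..<i}" using assms by auto
  then have "(\<Sum>l\<in>{1..<i}. U_gen n l j) = (\<Sum>l\<in>{1..<j}. U_gen n l j) + U_gen n j j"
    by (simp, subst sum.union_disjoint, auto simp: U_gen_def[of n _ j])
  then show ?thesis
    using assms False U_gen_column_sum[of j j n]
    by (simp del: One_nat_def add: Q_gen_def U_gen_def power_int_minus field_simps)
qed

lemma Q_hat_eq:
  assumes "2 \<le> n"
  shows "Q_hat n = mat1 n (\<lambda>i j. col_scale n j * Q_gen n i j)"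
  unfolding Q_hat_def
proof (rule mat1_cong)
  fix i j assume ij: "1 \<le> i" "i \<le> n" "1 \<le> j" "j \<le> n"
  have "alpha j \<noteq> 0" using alpha_ge_1[of j] by simp
  then show "(if j = n - 1 then (if i = n - 1 then 1 else 0) - (if i = n then 1 else 0)
      else if j = n then (if i < n then 2 powi (int n - 1 - int i) else 1)
      else (if i < j then - (real n - real j - 1) * 2 powi (int j - int i - 1)
            else if i = j then (real n - real j) * (alpha j - 1) + 1 else - alpha j))
    = col_scale n j * Q_gen n i j"
    using assms ij by (auto simp: col_scale_def Q_gen_def of_nat_diff algebra_simps)
qed

lemma Q_hat_form_eq:
  assumes n: "2 \<le> n" and k: "1 \<le> k" "k \<le> n"
  shows "Q_hat_form n k = elim_form n (\<lambda>i j. col_scale n j * U_gen n i j) k"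
  unfolding Q_hat_form_def elim_form_def
proof (rule mat1_cong, goal_cases)
  case (1 i j)
  note ij = this
  have a: "alpha j \<noteq> 0" using alpha_ge_1[of j] by simp
  have "col_scale n j * U_gen n i j - (\<Sum>l\<in>{k..<i}. col_scale n j * U_gen n l j)
      = col_scale n j * (U_gen n i j - (\<Sum>l\<in>{k..<i}. U_gen n l j))"
    by (simp add: sum_distrib_left right_diff_distrib)
  also have "U_gen n i j - (\<Sum>l\<in>{k..<i}. U_gen n l j) =
      (if i \<le> k then U_gen n i j else if j < k then 0
       else Q_gen n i j - (real n - real j - 1) * 2 powi (int j - int k - 1) * (alpha k - 1))"
  proof -
    \<comment> \<open>The first part of the split sum is the accumulated update, the second what row \<open>i\<close> still lacks.\<close>
    have "(\<Sum>l\<in>{1..<i}. U_gen n l j) = (\<Sum>l\<in>{1..<k}. U_gen n l j) + (\<Sum>l\<in>{k..<i}. U_gen n l j)"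
      if "k < i"
      using that k by (simp add: sum.atLeastLessThan_concat)
    moreover have "(\<Sum>l\<in>{k..<i}. U_gen n l j) = 0" if "j < k"
      using that by (intro sum.neutral) (auto simp: U_gen_def)
    moreover have "U_gen n i j = 0" if "j < i"
      using that by (simp add: U_gen_def)
    ultimately show ?thesis
      using ij k by (auto simp: Q_gen_eq U_gen_column_sum algebra_simps simp del: One_nat_def)
  qed
  finally have entry: "col_scale n j * U_gen n i j - (\<Sum>l\<in>{k..<i}. col_scale n j * U_gen n l j) =
      col_scale n j * (if i \<le> k then U_gen n i j else if j < k then 0
       else Q_gen n i j - (real n - real j - 1) * 2 powi (int j - int k - 1) * (alpha k - 1))" .
  consider "j = n - 1" | "j = n" "i = n" "k = n" | "j = n" "\<not> (i = n \<and> k = n)"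
    | "j \<noteq> n - 1" "j \<noteq> n" by blast
  then show ?case
  proof cases
    case 1
    then have "real n - real j - 1 = 0" using n by (simp add: of_nat_diff)
    then show ?thesis
      unfolding entry using 1 ij n k a
      by (auto simp: col_scale_def Q_gen_def U_gen_def)
  next
    case 2
    then show ?thesis
      unfolding entry using n by (simp add: U_gen_last col_scale_def)
  next
    case 3
    then show ?thesis
      unfolding entry using ij n k by (auto simp: col_scale_def Q_gen_def U_gen_def)
  next
    case 4
    then show ?thesis
      unfolding entry using ij k by (auto simp: col_scale_def Q_gen_def U_gen_def algebra_simps)
  qed
qed

lemma Q_gen_tail_sum_diag:
  assumes "a \<le> n"
  shows "(\<Sum>l\<in>{a<..n}. Q_gen n l a) = - ((real n - real a) * alpha a)"
  using assms by (simp add: Q_gen_def of_nat_diff algebra_simps)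

text \<open>From the bottom up: the diagonal entry together with the \<open>n - a\<close> entries below it sums to the entry
  just above the diagonal. From there on every entry is twice the one below it, just as the tail
  sum doubles with each entry that is equal to the sum of all lower ones.\<close>

lemma Q_gen_tail_sum:
  assumes "b < a" "a \<le> n"
  shows "(\<Sum>l\<in>{b<..n}. Q_gen n l a) = Q_gen n b a"
proof -
  obtain m where m: "a = Suc m" "b \<le> m"
    using assms by (cases a) auto
  have split: "(\<Sum>l\<in>{b<..n}. Q_gen n l a) = Q_gen n (Suc b) a + (\<Sum>l\<in>{Suc b<..n}. Q_gen n l a)"
    if "b \<le> m" for b
  proof -
    have "{b<..n} = insert (Suc b) {Suc b<..n}" using that m assms by auto
    then show ?thesis by simp
  qed
  show ?thesis
    using m(2)
  proof (induction rule: inc_induct)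
    case base
    have "(\<Sum>l\<in>{m<..n}. Q_gen n l a) = Q_gen n a a - (real n - real a) * alpha a"
      using split[of m] Q_gen_tail_sum_diag[OF assms(2)] m(1) by simp
    then show ?case
      using m(1) by (simp add: Q_gen_def algebra_simps)
  next
    case (step b)
    have "Q_gen n b a = 2 * Q_gen n (Suc b) a"
      using step.hyps m(1) by (simp add: Q_gen_def powi_pred[of "Suc m" b] del: of_nat_Suc)
    then show ?case
      using split[of b] step by simp
  qed
qed

text \<open>The right-hand side is the product of the diagonal entries of the two triangular matrices whose
  product is the Gram matrix of \<open>Q_hat n\<close>. Comparing it with the prescribed value for
  \<open>2 \<le> j \<le> n - 2\<close> is a matter of expanding in \<open>real n - real j\<close>; the constant term needs
  \<open>alpha j = 4 * alpha (j - 1) - 1\<close>.\<close>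

lemma d_hat_eq:
  assumes "2 \<le> n" "1 \<le> j" "j \<le> n"
  shows "d_hat n j = (col_scale n j)\<^sup>2 * (Q_gen n j j + (real n - real j) * alpha j) * U_gen n j j"
proof -
  have a: "alpha j \<noteq> 0" using alpha_ge_1[of j] by simp
  consider "j = n" | "j = n - 1" "j \<noteq> n" | "j = 1" "j < n - 1" | "2 \<le> j" "j < n - 1"
    using assms by linarith
  then show ?thesis
  proof cases
    case 1
    have "d_hat n n = 2 * alpha (n - 1)" "col_scale n n = 1" "Q_gen n n n = 1"
      using assms by (simp_all add: d_hat_def col_scale_def Q_gen_def)
    then show ?thesis
      unfolding 1 using U_gen_last[OF assms(1)] by simp
  next
    case 2
    then show ?thesis
      using assms a by (simp add: d_hat_def col_scale_def Q_gen_def U_gen_def of_nat_diff power2_eq_square)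
  next
    case 3
    then show ?thesis
      by (auto simp: d_hat_def col_scale_def Q_gen_def U_gen_def alpha_1)
  next
    case 4
    have aj: "alpha j = 4 * alpha (j - 1) - 1"
      using 4 alpha_Suc[of "j - 1"] by simp
    then have "alpha j \<noteq> 1"
      using alpha_ge_1[of "j - 1"] by simp
    then have frac: "(alpha j - 1)\<^sup>2 * ((2 * alpha j - 1) / (2 * alpha j - 2))
        = (alpha j - 1) * (2 * alpha j - 1) / 2"
      by (simp add: power2_eq_square divide_simps) (simp add: algebra_simps)
    have pred: "alpha (j - 1) = (alpha j + 1) / 4"
      using aj by simp
    have "d_hat n j =
        (real n - real j)\<^sup>2 * ((alpha j - 1)\<^sup>2 * ((2 * alpha j - 1) / (2 * alpha j - 2)))
        + (real n - real j) * ((alpha j)\<^sup>2 + alpha j - 1) + 2 * alpha (j - 1)"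
      using 4 unfolding d_hat_def mult.assoc by simp
    also have "\<dots> = (real n - real j)\<^sup>2 * ((alpha j - 1) * (2 * alpha j - 1) / 2)
        + (real n - real j) * ((alpha j)\<^sup>2 + alpha j - 1) + (alpha j + 1) / 2"
      unfolding frac pred by simp
    also have "\<dots> = (Q_gen n j j + (real n - real j) * alpha j) * U_gen n j j"
      by (simp add: Q_gen_def U_gen_def power2_eq_square field_simps)
    finally show ?thesis
      using 4 by (simp add: col_scale_def)
  qed
qed

theorem proposition3p1:
  fixes n :: nat
  assumes "2 \<le> n"
  shows "(\<exists>R. is_qr_factorization (L_mat n) (Q_hat n * diag_inv_sqrt (D_hat n)) R) \<and>
    qr_orthogonal_factor (L_mat n) = Q_hat n * diag_inv_sqrt (D_hat n) \<and>
    (\<forall>k \<in> {1..n}.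
       (\<forall>B. genp_form (Q_hat n) k B \<longleftrightarrow> B = Q_hat_form n k) \<and>
       (\<forall>B. gepp_form (Q_hat n) k B \<longleftrightarrow> B = Q_hat_form n k))"
proof -
  define U where "U = (\<lambda>i j. col_scale n j * U_gen n i j)"
  define T where "T = (\<lambda>i j. col_scale n i * (Q_gen n j i - (\<Sum>l\<in>{j<..n}. Q_gen n l i)))"
  have U_lower: "U i j = 0" if "j < i" for i j
    using that by (simp add: U_def U_gen_def)
  have U_pos: "0 < U i i" if "i \<le> n" for i
    using that by (simp add: U_def col_scale_pos U_gen_diag_pos)
  have T_lower: "T i j = 0" if "j < i" "i \<le> n" for i j
    using that by (simp add: T_def Q_gen_tail_sum)
  have T_diag: "T i i = col_scale n i * (Q_gen n i i + (real n - real i) * alpha i)" if "i \<le> n" for i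
    using that by (simp add: T_def Q_gen_tail_sum_diag)
  have T_pos: "0 < T i i" if "i \<le> n" for i
  proof -
    have "0 < Q_gen n i i" "0 \<le> (real n - real i) * alpha i"
      using that alpha_ge_1[of i] by (simp_all add: Q_gen_def add_nonneg_pos)
    then show ?thesis
      using that by (simp add: T_diag col_scale_pos)
  qed
  have QLU: "Q_hat n = L_mat n * mat1 n U"
    unfolding Q_hat_eq[OF assms] L_mat_eq mult_mat1
    by (rule mat1_cong)
      (simp add: L_entry_sum_left U_def Q_gen_eq sum_distrib_left right_diff_distrib del: One_nat_def)
  have QTL: "transpose_mat (Q_hat n) * L_mat n = mat1 n T"
    unfolding Q_hat_eq[OF assms] L_mat_eq transpose_mat1 mult_mat1
    by (rule mat1_cong)
      (simp add: L_entry_sum_right T_def sum_distrib_left right_diff_distrib del: One_nat_def)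
  have "is_qr_factorization (L_mat n) (Q_hat n * diag_inv_sqrt (D_hat n))
      (diag_inv_sqrt (D_hat n) * (transpose_mat (Q_hat n) * L_mat n))"
  proof (rule qr_factorization_of_gram[OF _ _ _ QLU], unfold QTL)
    show "Q_hat n \<in> carrier_mat n n" "L_mat n \<in> carrier_mat n n"
      by (simp_all add: Q_hat_def L_mat_eq)
    show "upper_triangular (mat1 n U)" "upper_triangular (mat1 n T)"
      using U_lower T_lower by (auto intro!: upper_triangular_mat1)
    show "D_hat n $$ (i, i) = mat1 n T $$ (i, i) * mat1 n U $$ (i, i)" if "i < n" for i
      using that assms
      by (simp add: D_hat_def mat1_def T_diag U_def d_hat_eq power2_eq_square)
  qed (use U_pos T_pos in \<open>simp_all add: D_hat_def, simp_all add: mat1_def\<close>)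
  then have qr: "\<exists>R. is_qr_factorization (L_mat n) (Q_hat n * diag_inv_sqrt (D_hat n)) R" ..
  moreover have "qr_orthogonal_factor (L_mat n) = Q_hat n * diag_inv_sqrt (D_hat n)"
    using qr qr_orthogonal_factor_eqI by blast
  moreover have "(genp_form (Q_hat n) k B \<longleftrightarrow> B = Q_hat_form n k) \<and>
      (gepp_form (Q_hat n) k B \<longleftrightarrow> B = Q_hat_form n k)" if "k \<in> {1..n}" for k B
  proof -
    have "U i i \<noteq> 0" if "i \<le> n" for i
      using U_pos[OF that] by simp
    moreover have "Q_hat_form n k = elim_form n U k"
      using that by (simp add: Q_hat_form_eq[OF assms] U_def)
    ultimately show ?thesis
      unfolding QLU using elimination_of_L_mult[of n U k B] U_lower that by simp
  qed
  ultimately show ?thesis by blast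
qed

end
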